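(* Let $n\ge2$ be an integer and $c\in\mathbb{R}\setminus\{0\}$, with $n$ odd, or $n$ even and $c<0$. For an angle $\theta$ put $a_\theta=\cos\theta$, $b_\theta=\sin\theta$ and $$F_\theta(x)=-\int_0^\infty e^{-(-c)^{n-1}\frac{t^n}{n}-ctxa_\theta}\sin(ctxb_\theta-\theta)\,dt,\qquad x\in\mathbb{R}.$$ (a) If $\theta\in[0,\pi]$ and $c\,a_\theta\ge0$, then $$\int_0^\infty F_\theta(x)\,dx=\begin{cases}\dfrac{\pi-\theta}{-c},&c<0,\\[2mm]\dfrac{\theta}{c},&c>0,\end{cases}$$ which does not depend on $n$. In particular, for $k\in\mathbb{N}$, $1\le k\le n/2$, with $c\cos(2k\pi/n)\ge0$, the function $y_k^-=F_{2k\pi/n}$ satisfies $$\int_0^\infty y_k^-(x)\,dx=\begin{cases}\dfrac{n-2k}{-nc}\,\pi,&c<0,\\[2mm]\dfrac{2k}{nc}\,\pi,&c>0.\end{cases}$$ (b) If $n$ is odd, $\theta\in[0,\pi]$ and $c\,a_\theta\le0$, then $$\int_{-\infty}^0F_\theta(x)\,dx=\begin{cases}\dfrac{\pi-\theta}{c},&c>0,\\[2mm]\dfrac{\theta}{-c},&c<0.\end{cases}$$ (c) If $n$ is odd and $a_\theta=0$ (and therefore $\theta=\pm\pi/2$ and $b_\theta=\pm1$), then $$-\int_{-\infty}^\infty dx\int_0^\infty e^{-(-c)^{n-1}\frac{t^n}{n}}\sin\Bigl(\pm ctx\mp\frac\pi2\Bigr)dt=\frac{\pi}{|c|},$$ which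 does not depend on $n$ and $\theta$.
   Context: The functions $y_k^-(x)=-\int_0^\infty e^{-(-c)^{n-1}\frac{w^n}{n}-cwxa_k}\sin\bigl(cwxb_k-\frac{2k\pi}{n}\bigr)dw$, with $a_k=\cos(2k\pi/n)$, $b_k=\sin(2k\pi/n)$, are solutions of the Airy-type equation $y^{(n-1)}+cxy=0$ in the case $n$ odd, or $n$ even and $c<0$. In (c), upper signs go together (case $\theta=\pi/2$) and lower signs go together (case $\theta=-\pi/2$).
   Formalization: In (c) the lower signs (θ = −π/2) give the value −π/|c| rather than π/|c|, because sin(−ctx+π/2) = −sin(ctx−π/2); so the value is independent of θ only up to sign. *)

theory Defs
  imports "HOL-Analysis.Analysis"
begin

text \<open>
  Integrals over unbounded sets are Henstock--Kurzweil integrals. By Hake's theorem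
  these agree with convergent improper Riemann integrals, absolutely convergent or not.
\<close>

definition F :: "nat \<Rightarrow> real \<Rightarrow> real \<Rightarrow> real \<Rightarrow> real" where
  "F n c \<theta> x =
     - integral {0..} (\<lambda>t. exp (- ((- c) ^ (n - 1) * (t ^ n / real n)) - c * t * x * cos \<theta>)
                           * sin (c * t * x * sin \<theta> - \<theta>))"

definition y_minus :: "nat \<Rightarrow> real \<Rightarrow> nat \<Rightarrow> real \<Rightarrow> real" where
  "y_minus n c k x =
     (let a = cos (2 * real k * pi / real n); b = sin (2 * real k * pi / real n) in
      - integral {0..} (\<lambda>w. exp (- ((- c) ^ (n - 1) * (w ^ n / real n)) - c * w * x * a)
                            * sin (c * w * x * b - 2 * real k * pi / real n)))"

lemma y_minus_eq_F: "y_minus n c k = F n c (2 * real k * pi / real n)"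
  by (simp add: fun_eq_iff y_minus_def F_def Let_def)

text \<open>
  \<^term>\<open>F n c \<theta>\<close> is odd in the angle. Hence an integral of \<^term>\<open>F n c (pi / 2)\<close> with
  the value \<^term>\<open>pi / \<bar>c\<bar>\<close> forces the value \<^term>\<open>- pi / \<bar>c\<bar>\<close> for the angle
  \<^term>\<open>- pi / 2\<close>. The same nonzero value for both angles is impossible.
\<close>

lemma F_uminus_angle: "F n c (- \<theta>) x = - F n c \<theta> x"
proof -
  have "exp (- ((- c) ^ (n - 1) * (t ^ n / real n)) - c * t * x * cos (- \<theta>))
          * sin (c * t * x * sin (- \<theta>) - (- \<theta>))
      = - (exp (- ((- c) ^ (n - 1) * (t ^ n / real n)) - c * t * x * cos \<theta>)
          * sin (c * t * x * sin \<theta> - \<theta>))" for t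
    using sin_minus[of "c * t * x * sin \<theta> - \<theta>"] by (simp add: algebra_simps)
  then show ?thesis
    unfolding F_def by (simp only: integral_neg)
qed

lemma not_same_value_both_angles:
  assumes "c \<noteq> 0" "(F n c (pi / 2) has_integral pi / \<bar>c\<bar>) UNIV"
  shows "\<not> (F n c (- (pi / 2)) has_integral pi / \<bar>c\<bar>) UNIV"
proof
  assume "(F n c (- (pi / 2)) has_integral pi / \<bar>c\<bar>) UNIV"
  moreover have "(F n c (- (pi / 2)) has_integral - (pi / \<bar>c\<bar>)) UNIV"
    using has_integral_neg[OF assms(2)] by (simp only: F_uminus_angle[symmetric])
  ultimately have "pi / \<bar>c\<bar> = - (pi / \<bar>c\<bar>)"
    by (rule has_integral_unique)
  then show False
    using assms(1) pi_gt_zero by (simp add: field_simps)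
qed

end

(* For c > 0 and 0 <= theta <= pi/2 put K = (-c)^(n-1)/n. By Fubini, the integral of F over [0,Y] is
   the integral over t >= 0 of exp(-K t^n) times exp(-c t Y cos theta) sin(c t Y sin theta) / (c t).
   The second factor is the t-derivative of S(c t Y)/c, where S(u) is the integral over [0,u] of
   exp(-v cos theta) sin(v sin theta) / v. Integration by parts moves the derivative to the first factor
   and gives the integral of w(t) S(c t Y)/c, where w(t) = K n t^(n-1) exp(-K t^n) has total mass 1.
   Since S is bounded and tends to theta, the limit for Y -> infinity is theta/c by dominated
   convergence. No absolute convergence in x is needed, so cos theta = 0 is included. The other
   cases follow from theta -> pi - theta and, for odd n, from (x,c) -> (-x,-c). *)

theory Submission
  imports Defs
begin

section \<open>Integrals over half-lines: limits, reflection, fundamental theorem\<close>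

text \<open>Half-line form of Hake's theorem, which also covers conditional convergence: a box
  around a large ball meets \<open>{a..}\<close> in \<open>{a..q}\<close> with \<open>q\<close>
  large, so the integral of the zero extension over the box is \<open>I q\<close>.\<close>

lemma has_integral_atLeast_limit:
  fixes f :: "real \<Rightarrow> 'a::banach"
  assumes f: "\<And>b. a \<le> b \<Longrightarrow> (f has_integral I b) {a..b}"
    and lim: "(I \<longlongrightarrow> L) at_top"
  shows "(f has_integral L) {a..}"
proof -
  have box: "((\<lambda>x. if x \<in> {a..} then f x else 0) has_integral (if a \<le> q then I q else 0)) {p..q}"
    if "p \<le> a" for p q
  proof (cases "a \<le> q")
    case True
    have "((\<lambda>x. if x \<in> {a..} then f x else 0) has_integral I q) {a..q}"
      by (rule has_integral_eq[OF _ f[OF True]]) auto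
    moreover have "((\<lambda>x. if x \<in> {a..} then f x else 0) has_integral 0) {p..a}"
      by (rule has_integral_spike_finite[of "{a}" _ _ "\<lambda>_. 0"]) auto
    ultimately show ?thesis
      using has_integral_combine[of p a q "\<lambda>x. if x \<in> {a..} then f x else 0" 0 "I q"] that True
      by simp
  next
    case False
    then show ?thesis
      by (auto intro!: has_integral_is_0)
  qed
  have "(\<lambda>x. if x \<in> {a..} then f x else 0) integrable_on cbox p q" for p q
  proof -
    \<comment> \<open>Moving the left end down to at most \<open>a\<close> makes \<open>box\<close>
      applicable; integrability then restricts to the smaller interval.\<close>
    have "(\<lambda>x. if x \<in> {a..} then f x else 0) integrable_on {min p a..q}"
      using box[of "min p a" q] by (auto simp: integrable_on_def)
    then show ?thesis
      unfolding cbox_interval by (rule integrable_on_subinterval) auto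
  qed
  moreover have "\<exists>B>0. \<forall>p q. ball 0 B \<subseteq> cbox p q \<longrightarrow>
      norm (integral (cbox p q) (\<lambda>x. if x \<in> {a..} then f x else 0) - L) < e" if e: "e > 0" for e
  proof -
    obtain N where N: "\<And>b. N \<le> b \<Longrightarrow> dist (I b) L < e"
      using tendstoD[OF lim e] by (auto simp: eventually_at_top_linorder)
    \<comment> \<open>The radius exceeds \<open>max \<bar>a\<bar> \<bar>N\<bar>\<close>, so a box
      containing the ball contains plus and minus this number. This forces \<open>p \<le> a\<close>,
      \<open>a \<le> q\<close> and \<open>N \<le> q\<close>.\<close>
    define B where "B = max 1 (max \<bar>a\<bar> \<bar>N\<bar>) + 1"
    have "norm (integral (cbox p q) (\<lambda>x. if x \<in> {a..} then f x else 0) - L) < e"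
      if sub: "ball 0 B \<subseteq> cbox p q" for p q
    proof -
      define r where "r = max \<bar>a\<bar> \<bar>N\<bar>"
      have "- r \<in> ball 0 B" "r \<in> ball 0 B"
        by (auto simp: B_def r_def)
      then have "- r \<in> {p..q}" "r \<in> {p..q}"
        using sub unfolding cbox_interval by blast+
      then have "p \<le> - r" "r \<le> q"
        by auto
      then have "p \<le> a" "a \<le> q" "N \<le> q"
        by (auto simp: r_def)
      then show ?thesis
        using integral_unique[OF box[of p q]] N[of q] by (simp add: dist_norm)
    qed
    moreover have "B > 0"
      by (auto simp: B_def)
    ultimately show ?thesis
      by blast
  qed
  ultimately show ?thesis
    by (subst has_integral_alt') blast
qed

text \<open>Negation maps \<open>ball 0 B\<close> to itself and boxes to boxes, so the same radius
  \<open>B\<close> serves both sides. This carries integrals over \<open>{0..}\<close> to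
  \<open>{..0}\<close>.\<close>

lemma has_integral_reflect_image:
  fixes f :: "'n::euclidean_space \<Rightarrow> 'a::banach"
  assumes "(f has_integral i) S"
  shows "((\<lambda>x. f (- x)) has_integral i) (uminus ` S)"
proof (subst has_integral', intro allI impI)
  fix e :: real assume "e > 0"
  then obtain B where B: "B > 0" "\<And>a b. ball 0 B \<subseteq> cbox a b \<Longrightarrow>
      \<exists>z. ((\<lambda>x. if x \<in> S then f x else 0) has_integral z) (cbox a b) \<and> norm (z - i) < e"
    using assms by (subst (asm) has_integral') meson
  have "\<exists>z. ((\<lambda>x. if x \<in> uminus ` S then f (- x) else 0) has_integral z) (cbox a b) \<and> norm (z - i) < e"
    if "ball 0 B \<subseteq> cbox a b" for a b
  proof -
    have "ball 0 B \<subseteq> cbox (- b) (- a)"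
    proof
      fix x :: 'n assume "x \<in> ball 0 B"
      then have "- x \<in> cbox a b"
        using that by (auto simp: subset_iff)
      then show "x \<in> cbox (- b) (- a)"
        by (auto simp: mem_box)
    qed
    then obtain z where "((\<lambda>x. if x \<in> S then f x else 0) has_integral z) (cbox (- b) (- a))"
      and z: "norm (z - i) < e"
      using B(2) by blast
    from has_integral_reflect_lemma[OF this(1)]
    have "((\<lambda>x. if - x \<in> S then f (- x) else 0) has_integral z) (cbox a b)"
      by simp
    moreover have "- x \<in> S \<longleftrightarrow> x \<in> uminus ` S" for x
      by (force simp: image_iff)
    ultimately show ?thesis
      using z by auto
  qed
  with B(1) show "\<exists>B>0. \<forall>a b. ball 0 B \<subseteq> cbox a b \<longrightarrow>
      (\<exists>z. ((\<lambda>x. if x \<in> uminus ` S then f (- x) else 0) has_integral z) (cbox a b) \<and> norm (z - i) < e)"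
    by blast
qed

text \<open>The derivative is asked for only at \<open>x > a\<close>. The later integration by parts
  relies on this, because its integrand contains a quotient by \<open>t\<close> on
  \<open>{0..}\<close>.\<close>

lemma fundamental_theorem_of_calculus_atLeast:
  fixes G :: "real \<Rightarrow> real"
  assumes "continuous_on {a..} G"
    and "\<And>x. a < x \<Longrightarrow> (G has_real_derivative g x) (at x)"
    and "(G \<longlongrightarrow> L) at_top"
  shows "(g has_integral L - G a) {a..}"
proof (rule has_integral_atLeast_limit)
  show "(g has_integral G b - G a) {a..b}" if "a \<le> b" for b
    using that assms(2)
    by (intro fundamental_theorem_of_calculus_interior continuous_on_subset[OF assms(1)])
       (auto simp: has_real_derivative_iff_has_vector_derivative[symmetric])
  show "((\<lambda>b. G b - G a) \<longlongrightarrow> L - G a) at_top"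
    by (intro tendsto_intros assms)
qed

lemma has_bochner_integral_FTC_atLeast:
  fixes f :: "real \<Rightarrow> real"
  assumes [measurable]: "f \<in> borel_measurable borel"
    and "\<And>x. a \<le> x \<Longrightarrow> (G has_real_derivative f x) (at x)"
    and nonneg: "\<And>x. a \<le> x \<Longrightarrow> 0 \<le> f x"
    and "(G \<longlongrightarrow> L) at_top"
  shows "has_bochner_integral lborel (\<lambda>x. indicator {a..} x * f x) (L - G a)"
proof (rule has_bochner_integral_nn_integral)
  have "((\<lambda>x. f x) has_integral L - G a) {a..}"
    using assms
    by (intro fundamental_theorem_of_calculus_atLeast continuous_at_imp_continuous_on)
       (auto intro: DERIV_isCont)
  then show "0 \<le> L - G a"
    by (rule has_integral_nonneg) (auto intro: nonneg)
  have "(\<integral>\<^sup>+x. ennreal (indicator {a..} x * f x) \<partial>lborel)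
      = (\<integral>\<^sup>+x. ennreal (f x) * indicator {a..} x \<partial>lborel)"
    by (intro nn_integral_cong) (auto split: split_indicator)
  then show "(\<integral>\<^sup>+x. ennreal (indicator {a..} x * f x) \<partial>lborel) = ennreal (L - G a)"
    using assms by (simp add: nn_integral_FTC_atLeast)
qed (use nonneg in \<open>auto split: split_indicator\<close>)

section \<open>The weight \<open>exp (- (K * t ^ n))\<close>\<close>

lemma tendsto_exp_neg_power_at_top:
  fixes K :: real
  assumes "K > 0" "n > 0"
  shows "((\<lambda>t. exp (- (K * t ^ n))) \<longlongrightarrow> 0) at_top"
proof -
  have "filterlim (\<lambda>t. K * t ^ n) at_top at_top"
    by (rule filterlim_tendsto_pos_mult_at_top[OF tendsto_const assms(1)])
       (rule filterlim_pow_at_top[OF assms(2) filterlim_ident])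
  then show ?thesis
    by (intro filterlim_compose[OF exp_at_bot] filterlim_compose[OF filterlim_uminus_at_bot_at_top])
qed

text \<open>Since \<open>t \<le> t ^ n + 1\<close> for \<open>t \<ge> 0\<close>, the function is
  dominated by \<open>exp K * exp (- (K * t))\<close>, which has an explicit antiderivative.\<close>

lemma set_integrable_exp_neg_power:
  fixes K :: real
  assumes "K > 0" "n > 0"
  shows "set_integrable lborel {0..} (\<lambda>t. exp (- (K * t ^ n)))"
proof -
  have "((\<lambda>t. - exp (- (K * t)) / K) \<longlongrightarrow> - 0 / K) at_top"
    using tendsto_exp_neg_power_at_top[OF assms(1), of 1] assms(1) by (intro tendsto_intros) auto
  then have "has_bochner_integral lborel (\<lambda>t. indicator {0..} t * exp (- (K * t)))
      (0 - (- exp (- (K * 0)) / K))"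
    using assms(1) by (intro has_bochner_integral_FTC_atLeast)
      (auto intro!: derivative_eq_intros)
  then have "set_integrable lborel {0..} (\<lambda>t. exp (- (K * t)))"
    by (auto simp: set_integrable_def has_bochner_integral_iff)
  then have "set_integrable lborel {0..} (\<lambda>t. exp K * exp (- (K * t)))"
    by simp
  then show ?thesis
  proof (rule set_integrable_bound)
    have "exp (- (K * t ^ n)) \<le> exp K * exp (- (K * t))" if "t \<ge> 0" for t
    proof -
      have "t \<le> t ^ n + 1"
        using self_le_power[of t n] zero_le_power[OF that, of n] assms(2) by (cases "t \<ge> 1") auto
      then have "K * t \<le> K * (t ^ n + 1)"
        using assms(1) by (intro mult_left_mono) auto
      then show ?thesis
        by (simp add: exp_add[symmetric] algebra_simps)
    qed
    then show "AE t in lborel. t \<in> {0..} \<longrightarrow> norm (exp (- (K * t ^ n))) \<le> norm (exp K * exp (- (K * t)))"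
      by auto
  qed (auto simp: set_borel_measurable_def)
qed

text \<open>The integrand is the derivative of \<open>- exp (- (K * t ^ n))\<close>. Total mass 1 is
  why the final values do not depend on \<open>n\<close>.\<close>

lemma has_bochner_integral_power_exp_neg_power:
  fixes K :: real
  assumes "K > 0" "n > 0"
  shows "has_bochner_integral lborel
    (\<lambda>t. indicator {0..} t * (K * real n * t ^ (n - 1) * exp (- (K * t ^ n)))) 1"
proof -
  have "((\<lambda>t. - exp (- (K * t ^ n))) \<longlongrightarrow> - 0) at_top"
    by (intro tendsto_minus tendsto_exp_neg_power_at_top assms)
  then have "has_bochner_integral lborel
      (\<lambda>t. indicator {0..} t * (K * real n * t ^ (n - 1) * exp (- (K * t ^ n))))
      (0 - (- exp (- (K * 0 ^ n))))"
    using assms by (intro has_bochner_integral_FTC_atLeast)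
      (auto intro!: derivative_eq_intros)
  then show ?thesis
    using assms by (simp add: power_0_left)
qed

section \<open>The function \<open>ray_integral\<close>: derivative, bound and limit\<close>

text \<open>
  \<^term>\<open>ray_integral \<theta> u\<close> is the integral over \<open>v \<in> [0, u]\<close> of \<open>exp (- v * cos \<theta>) * sin (v * sin \<theta>) / v\<close>,
  the imaginary part of \<open>exp (- v * exp (- \<i> * \<theta>)) / v\<close>.
  Rotating the ray of integration to the real axis, where that imaginary part vanishes, leaves the
  arc between the two, which is the defining formula: it has no singularity, and makes the limit
  \<open>\<theta>\<close> for \<open>u\<close> tending to infinity a matter of dominated convergence, also for \<open>\<theta> = pi / 2\<close>.
\<close>

definition ray_integral :: "real \<Rightarrow> real \<Rightarrow> real" where
  "ray_integral \<theta> u = \<theta> - integral {0..\<theta>} (\<lambda>\<phi>. exp (- (u * cos \<phi>)) * cos (u * sin \<phi>))"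

lemma ray_integral_0 [simp]: "0 \<le> \<theta> \<Longrightarrow> ray_integral \<theta> 0 = 0"
  by (simp add: ray_integral_def)

text \<open>Differentiate under the integral sign; \<open>u\<close> times the result is an exact
  derivative in \<open>\<phi>\<close>, namely of
  \<open>exp (- (u * cos \<phi>)) * sin (u * sin \<phi>)\<close>. The product form
  \<open>u * d\<close> avoids dividing by zero at \<open>u = 0\<close>.\<close>

lemma ray_integral_has_derivative:
  assumes "0 \<le> \<theta>"
  obtains d where "(ray_integral \<theta> has_real_derivative d) (at u)"
    and "u * d = exp (- (u * cos \<theta>)) * sin (u * sin \<theta>)"
proof -
  define k where "k v \<phi> = - exp (- (v * cos \<phi>)) * (cos \<phi> * cos (v * sin \<phi>) + sin \<phi> * sin (v * sin \<phi>))"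
    for v \<phi> :: real
  have "((\<lambda>v. integral (cbox 0 \<theta>) (\<lambda>\<phi>. exp (- (v * cos \<phi>)) * cos (v * sin \<phi>)))
      has_real_derivative integral (cbox 0 \<theta>) (k u)) (at u within UNIV)"
    by (rule leibniz_rule_field_derivative)
       (auto intro!: derivative_eq_intros integrable_continuous_interval continuous_intros
             simp: k_def split_beta algebra_simps)
  then have "(ray_integral \<theta> has_real_derivative 0 - integral {0..\<theta>} (k u)) (at u)"
    unfolding ray_integral_def[abs_def] by (intro DERIV_diff DERIV_const) simp
  moreover have "((\<lambda>\<phi>. u * (- k u \<phi>)) has_integral
      exp (- (u * cos \<theta>)) * sin (u * sin \<theta>) - exp (- (u * cos 0)) * sin (u * sin 0)) {0..\<theta>}"
    using assms
    by (intro fundamental_theorem_of_calculus)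
       (auto intro!: derivative_eq_intros simp: k_def algebra_simps
             has_real_derivative_iff_has_vector_derivative[symmetric])
  then have "u * (0 - integral {0..\<theta>} (k u)) = exp (- (u * cos \<theta>)) * sin (u * sin \<theta>)"
    by (simp add: has_integral_iff)
  ultimately show thesis
    using that by blast
qed

lemma isCont_ray_integral: "0 \<le> \<theta> \<Longrightarrow> isCont (ray_integral \<theta>) u"
  by (metis ray_integral_has_derivative DERIV_isCont)

lemma borel_measurable_ray_integral [measurable]: "0 \<le> \<theta> \<Longrightarrow> ray_integral \<theta> \<in> borel_measurable borel"
  by (intro borel_measurable_continuous_onI continuous_at_imp_continuous_on) (auto simp: isCont_ray_integral)

text \<open>For angles up to \<open>pi / 2\<close> the cosine is nonnegative, so the integrand on
  the arc is at most 1 in absolute value. The bound is uniform in \<open>u\<close> and serves for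
  domination.\<close>

lemma abs_ray_integral_le:
  assumes "0 \<le> \<theta>" "\<theta> \<le> pi / 2" "0 \<le> u"
  shows "\<bar>ray_integral \<theta> u\<bar> \<le> 2 * \<theta>"
proof -
  have "norm (integral (cbox 0 \<theta>) (\<lambda>\<phi>. exp (- (u * cos \<phi>)) * cos (u * sin \<phi>)))
      \<le> 1 * measure lborel (cbox 0 \<theta>)"
  proof (rule integrable_bound)
    show "norm (exp (- (u * cos \<phi>)) * cos (u * sin \<phi>)) \<le> 1" if "\<phi> \<in> cbox 0 \<theta>" for \<phi>
      using that assms cos_ge_zero[of \<phi>]
      by (auto simp: abs_mult intro!: mult_le_one)
  qed (auto intro!: integrable_continuous_interval continuous_intros)
  then show ?thesis
    using assms by (simp add: ray_integral_def)
qed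

text \<open>The arc integrand decays to 0 wherever \<open>cos \<phi> > 0\<close>, that is,
  everywhere on the arc except possibly at the single point \<open>pi / 2\<close>, which is a null
  set.\<close>

lemma ray_integral_tendsto:
  assumes "0 \<le> \<theta>" "\<theta> \<le> pi / 2"
  shows "(ray_integral \<theta> \<longlongrightarrow> \<theta>) at_top"
proof -
  let ?g = "\<lambda>u \<phi>. indicator {0..\<theta>} \<phi> * (exp (- (u * cos \<phi>)) * cos (u * sin \<phi>)) :: real"
  have "((\<lambda>u. \<integral>\<phi>. ?g u \<phi> \<partial>lborel) \<longlongrightarrow> (\<integral>\<phi>. (0::real) \<partial>(lborel :: real measure))) at_top"
  proof (rule integral_dominated_convergence_at_top)
    show "integrable lborel (indicator {0..\<theta>} :: real \<Rightarrow> real)"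
      using assms by (intro integrable_real_indicator) auto
    have "((\<lambda>u. ?g u \<phi>) \<longlongrightarrow> 0) at_top" if "\<phi> \<noteq> pi / 2" for \<phi>
    proof (cases "\<phi> \<in> {0..\<theta>}")
      case True
      then have "cos \<phi> > 0"
        using that assms by (intro cos_gt_zero_pi) auto
      then have "((\<lambda>u. exp (- (cos \<phi> * u ^ 1))) \<longlongrightarrow> 0) at_top"
        by (rule tendsto_exp_neg_power_at_top) simp
      then have "((\<lambda>u. ?g u \<phi>) \<longlongrightarrow> 0) at_top"
        by (rule Lim_null_comparison[rotated])
           (auto simp: abs_mult mult.commute[of _ "cos \<phi>"] indicator_def True intro!: mult_left_le always_eventually)
      then show ?thesis .
    qed auto
    then show "AE \<phi> in lborel. ((\<lambda>u. ?g u \<phi>) \<longlongrightarrow> 0) at_top"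
      using AE_lborel_singleton[of "pi / 2"] by (rule_tac AE_mp) auto
    have "norm (?g u \<phi>) \<le> indicator {0..\<theta>} \<phi>" if "u \<ge> 0" for u \<phi>
      using that assms cos_ge_zero[of \<phi>]
      by (auto simp: abs_mult indicator_def intro!: mult_le_one)
    then show "\<forall>\<^sub>F u in at_top. AE \<phi> in lborel. norm (?g u \<phi>) \<le> indicator {0..\<theta>} \<phi>"
      by (intro eventually_mono[OF eventually_ge_at_top[of "0::real"]] AE_I2)
  qed auto
  moreover have "(\<integral>\<phi>. ?g u \<phi> \<partial>lborel)
      = integral {0..\<theta>} (\<lambda>\<phi>. exp (- (u * cos \<phi>)) * cos (u * sin \<phi>))" for u
  proof -
    have "set_integrable lborel {0..\<theta>} (\<lambda>\<phi>. exp (- (u * cos \<phi>)) * cos (u * sin \<phi>))"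
      by (intro borel_integrable_atLeastAtMost' continuous_intros)
    from set_borel_integral_eq_integral(2)[OF this] show ?thesis
      by (simp add: set_lebesgue_integral_def)
  qed
  ultimately have "((\<lambda>u. \<theta> - integral {0..\<theta>} (\<lambda>\<phi>. exp (- (u * cos \<phi>)) * cos (u * sin \<phi>)))
      \<longlongrightarrow> \<theta> - 0) at_top"
    by (intro tendsto_intros) simp
  then show ?thesis
    by (simp add: ray_integral_def[abs_def])
qed


section \<open>The damped sine integral with positive rate \<open>m\<close>\<close>

text \<open>On the bounded range \<open>{0..Y}\<close> the double integral converges absolutely, so
  Fubini applies. Integration by parts in \<open>t\<close> then replaces the quotient by
  \<open>t\<close> with the bounded \<open>ray_integral\<close>, in a form ready for the limit in
  \<open>Y\<close>.\<close>

lemma has_integral_damped_sine: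
  fixes K m \<theta> Y :: real and n :: nat
  assumes K: "K > 0" and n: "n > 0" and m: "m > 0" and \<theta>: "0 \<le> \<theta>" "\<theta> \<le> pi / 2" and Y: "0 \<le> Y"
  shows "((\<lambda>x. - integral {0..} (\<lambda>t. exp (- (K * t ^ n) - m * t * x * cos \<theta>)
             * sin (m * t * x * sin \<theta> - \<theta>)))
    has_integral (\<integral>t. indicator {0..} t * (K * real n * t ^ (n - 1) * exp (- (K * t ^ n)))
             * (ray_integral \<theta> (m * t * Y) / m) \<partial>lborel)) {0..Y}"
    (is "(?G has_integral ?P) _")
proof -
  define E where "E t = exp (- (K * t ^ n))" for t :: real
  define w where "w t = K * real n * t ^ (n - 1) * E t" for t :: real
  define g where "g x t = - (exp (- (m * t * x * cos \<theta>)) * sin (m * t * x * sin \<theta> - \<theta>))" for x t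
  \<comment> \<open>The full integrand, cut off by indicators so that both iterated integrals run
    over all of \<open>lborel\<close>.\<close>
  define q where "q x t = indicator {0..Y} x * (indicator {0..} t * (E t * g x t))" for x t :: real
  define D where "D t = exp (- (m * t * Y * cos \<theta>)) * sin (m * t * Y * sin \<theta>) / (m * t)" for t
  define H where "H t = ray_integral \<theta> (m * t * Y) / m" for t
  have a: "cos \<theta> \<ge> 0"
    using \<theta> by (intro cos_ge_zero) auto
  have [measurable]: "E \<in> borel_measurable borel" "w \<in> borel_measurable borel"
    "D \<in> borel_measurable borel" "H \<in> borel_measurable borel"
    using \<theta>(1) by (simp_all add: E_def[abs_def] w_def[abs_def] D_def[abs_def] H_def[abs_def])
  have intE: "integrable lborel (\<lambda>t. indicator {0..} t * E t)"
    using set_integrable_exp_neg_power[OF K n] by (simp add: set_integrable_def E_def)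
  \<comment> \<open>With \<open>cos \<theta> \<ge> 0\<close>, \<open>x \<ge> 0\<close> and
    \<open>t \<ge> 0\<close>, the oscillating factor is at most 1 in absolute value.\<close>
  have q_le: "norm (q x t) \<le> indicator {0..Y} x * (indicator {0..} t * E t)" for x t
    using a m by (auto simp: q_def g_def E_def abs_mult indicator_def intro!: mult_le_one)
  have "integrable (lborel \<Otimes>\<^sub>M lborel) (\<lambda>(x, t). indicator {0..Y} x * (indicator {0..} t * E t))"
    using intE Y by (intro lborel_pair.Fubini_integrable) (auto simp: abs_mult)
  then have int_q: "integrable (lborel \<Otimes>\<^sub>M lborel) (\<lambda>(x, t). q x t)"
  proof (rule Bochner_Integration.integrable_bound)
    show "AE p in lborel \<Otimes>\<^sub>M lborel. norm (case p of (x, t) \<Rightarrow> q x t)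
        \<le> norm (case p of (x, t) \<Rightarrow> indicator {0..Y} x * (indicator {0..} t * E t))"
    proof (rule AE_I2)
      fix p :: "real \<times> real"
      show "norm (case p of (x, t) \<Rightarrow> q x t)
        \<le> norm (case p of (x, t) \<Rightarrow> indicator {0..Y} x * (indicator {0..} t * E t))"
        using q_le[of "fst p" "snd p"] by (simp add: split_beta)
    qed
  qed (simp add: q_def[abs_def] g_def[abs_def] split_beta)
  have inner_t: "(\<integral>t. q x t \<partial>lborel) = indicator {0..Y} x * ?G x" for x
  proof (cases "x \<in> {0..Y}")
    case True
    have "set_integrable lborel {0..} (\<lambda>t. E t * g x t)"
      unfolding set_integrable_def
    proof (rule Bochner_Integration.integrable_bound[OF intE])
      show "AE t in lborel. norm (indicator {0..} t *\<^sub>R (E t * g x t)) \<le> norm (indicator {0..} t * E t)"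
        using q_le[of x] True by (simp add: q_def E_def abs_mult)
    qed (simp add: g_def[abs_def])
    then have "(\<integral>t. q x t \<partial>lborel) = integral {0..} (\<lambda>t. E t * g x t)"
      using set_borel_integral_eq_integral(2)[of "{0..}" "\<lambda>t. E t * g x t"] True
      by (simp add: q_def set_lebesgue_integral_def)
    also have "(\<lambda>t. E t * g x t) = (\<lambda>t. - (exp (- (K * t ^ n) - m * t * x * cos \<theta>)
             * sin (m * t * x * sin \<theta> - \<theta>)))"
      by (auto simp: E_def g_def exp_diff exp_minus field_simps)
    finally show ?thesis
      using True by (simp add: integral_neg)
  qed (simp add: q_def)
  \<comment> \<open>The point \<open>t = 0\<close> is left out: \<open>D 0\<close> is 0 by the
    convention for division by zero, whereas the integral there is
    \<open>Y * sin \<theta>\<close>.\<close>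
  have inner_x: "(\<integral>x. q x t \<partial>lborel) = indicator {0..} t * (E t * D t)" if "t \<noteq> 0" for t
  proof (cases "t > 0")
    case True
    \<comment> \<open>An antiderivative of \<open>g\<close> in \<open>x\<close>: differentiating the
      product of exponential and sine produces exactly the phase shift by
      \<open>\<theta>\<close>.\<close>
    define A where "A x = exp (- (m * t * x * cos \<theta>)) * sin (m * t * x * sin \<theta>) / (m * t)" for x
    have "((\<lambda>x. g x t) has_integral A Y - A 0) {0..Y}"
    proof (intro fundamental_theorem_of_calculus Y)
      fix x
      have "(A has_real_derivative g x t) (at x within {0..Y})"
        using True m unfolding A_def
        by (auto intro!: derivative_eq_intros simp: g_def sin_diff field_simps)
      then show "(A has_vector_derivative g x t) (at x within {0..Y})"
        by (simp add: has_real_derivative_iff_has_vector_derivative)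
    qed
    then have "integral {0..Y} (\<lambda>x. g x t) = D t"
      by (simp add: integral_unique A_def D_def)
    moreover have "set_integrable lborel {0..Y} (\<lambda>x. g x t)"
      unfolding g_def by (intro borel_integrable_atLeastAtMost' continuous_intros)
    ultimately have "(\<integral>x. indicator {0..Y} x * g x t \<partial>lborel) = D t"
      using set_borel_integral_eq_integral(2)[of "{0..Y}" "\<lambda>x. g x t"]
      by (simp add: set_lebesgue_integral_def)
    moreover have "(\<integral>x. q x t \<partial>lborel) = (\<integral>x. E t * (indicator {0..Y} x * g x t) \<partial>lborel)"
      using True by (intro Bochner_Integration.integral_cong) (auto simp: q_def)
    ultimately show ?thesis
      using True by simp
  qed (use that in \<open>simp add: q_def\<close>)
  have "integrable lborel (\<lambda>x. \<integral>t. q x t \<partial>lborel)"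
    using lborel_pair.integrable_fst[OF int_q] .
  then have "set_integrable lborel {0..Y} ?G"
    by (simp add: inner_t set_integrable_def)
  then have "(?G has_integral (\<integral>x. \<integral>t. q x t \<partial>lborel \<partial>lborel)) {0..Y}"
    using set_borel_integral_eq_integral[of "{0..Y}" ?G]
    by (simp add: has_integral_iff inner_t set_lebesgue_integral_def)
  also have "(\<integral>x. \<integral>t. q x t \<partial>lborel \<partial>lborel) = (\<integral>t. \<integral>x. q x t \<partial>lborel \<partial>lborel)"
    by (rule lborel_pair.Fubini_integral[OF int_q, symmetric])
  finally have G: "(?G has_integral (\<integral>t. \<integral>x. q x t \<partial>lborel \<partial>lborel)) {0..Y}" .
  have AE: "AE t in lborel. (\<integral>x. q x t \<partial>lborel) = indicator {0..} t * (E t * D t)"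
    using AE_lborel_singleton[of "0::real"] by eventually_elim (rule inner_x)
  have int: "integrable lborel (\<lambda>t. \<integral>x. q x t \<partial>lborel)"
    using lborel_pair.integrable_snd[OF int_q] .
  have H_le: "\<bar>H t\<bar> \<le> 2 * \<theta> / m" if "0 \<le> t" for t
    using abs_ray_integral_le[OF \<theta>, of "m * t * Y"] that m Y by (simp add: H_def field_simps)
  have int_w: "set_integrable lborel {0..} (\<lambda>t. w t * H t)"
    unfolding set_integrable_def
  proof (rule Bochner_Integration.integrable_bound)
    show "integrable lborel (\<lambda>t. indicator {0..} t * w t * (2 * \<theta> / m))"
      using has_bochner_integral_power_exp_neg_power[OF K n]
      by (intro integrable_mult_left) (auto simp: has_bochner_integral_iff w_def E_def)
    show "AE t in lborel. norm (indicator {0..} t *\<^sub>R (w t * H t))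
        \<le> norm (indicator {0..} t * w t * (2 * \<theta> / m))"
    proof (rule AE_I2)
      fix t
      show "norm (indicator {0..} t *\<^sub>R (w t * H t)) \<le> norm (indicator {0..} t * w t * (2 * \<theta> / m))"
      proof (cases "t \<ge> 0")
        case True
        have "\<bar>w t\<bar> * \<bar>H t\<bar> \<le> \<bar>w t\<bar> * \<bar>2 * \<theta> / m\<bar>"
          using order_trans[OF H_le[OF True] abs_ge_self] by (intro mult_left_mono) auto
        then show ?thesis
          using True by (simp add: abs_mult)
      qed simp
    qed
  qed simp
  note meas = borel_measurable_integrable[OF int]
  \<comment> \<open>Integrability comes from Fubini, since the function agrees almost everywhere
    with the inner integral over \<open>x\<close>; \<open>D\<close> itself is not estimated.\<close>
  have int_D: "set_integrable lborel {0..} (\<lambda>t. E t * D t)"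
    unfolding set_integrable_def
    using int AE meas by (subst integrable_cong_AE[where g="\<lambda>t. \<integral>x. q x t \<partial>lborel"]) auto
  have "(\<integral>t. \<integral>x. q x t \<partial>lborel \<partial>lborel) = (\<integral>t. indicator {0..} t * (E t * D t) \<partial>lborel)"
    using AE meas by (intro integral_cong_AE) auto
  also have "\<dots> = integral {0..} (\<lambda>t. E t * D t)"
    using set_borel_integral_eq_integral(2)[OF int_D] by (simp add: set_lebesgue_integral_def)
  also have "\<dots> = integral {0..} (\<lambda>t. w t * H t)"
  proof -
    have H: "(H has_real_derivative D t) (at t)" if "t > 0" for t
    proof -
      obtain d where d: "(ray_integral \<theta> has_real_derivative d) (at (m * t * Y))"
        "m * t * Y * d = exp (- (m * t * Y * cos \<theta>)) * sin (m * t * Y * sin \<theta>)"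
        using ray_integral_has_derivative[OF \<theta>(1)] by blast
      have "(H has_real_derivative d * (m * Y) / m) (at t)"
        unfolding H_def using m
        by (intro DERIV_cdivide DERIV_chain2[where f="ray_integral \<theta>" and g="\<lambda>t. m * t * Y", OF d(1)])
           (auto intro!: derivative_eq_intros)
      also have "d * (m * Y) / m = D t"
        using d(2) m that by (simp add: D_def field_simps)
      finally show ?thesis .
    qed
    \<comment> \<open>Integration by parts with antiderivative \<open>E t * H t\<close>. Both
      boundary terms vanish: \<open>H 0 = 0\<close>, and at infinity \<open>E\<close> decays while
      \<open>H\<close> stays bounded.\<close>
    have "((\<lambda>t. E t * D t - w t * H t) has_integral 0 - E 0 * H 0) {0..}"
    proof (rule fundamental_theorem_of_calculus_atLeast)
      have "continuous_on UNIV (ray_integral \<theta>)"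
        using isCont_ray_integral[OF \<theta>(1)] by (intro continuous_at_imp_continuous_on) auto
      then have "continuous_on {0..} (\<lambda>t. ray_integral \<theta> (m * t * Y))"
        by (rule continuous_on_compose2) (auto intro!: continuous_intros)
      then show "continuous_on {0..} (\<lambda>t. E t * H t)"
        unfolding E_def H_def using m by (intro continuous_intros) auto
      show "((\<lambda>t. E t * H t) has_real_derivative E t * D t - w t * H t) (at t)" if "0 < t" for t
      proof -
        have "(E has_real_derivative - w t) (at t)"
          unfolding E_def[abs_def] w_def by (auto intro!: derivative_eq_intros)
        from DERIV_mult[OF this H[OF that]] show ?thesis
          by (simp add: algebra_simps)
      qed
      have "((\<lambda>t. E t * (2 * \<theta> / m)) \<longlongrightarrow> 0) at_top"
        unfolding E_def by (intro tendsto_mult_left_zero tendsto_exp_neg_power_at_top K n)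
      moreover have "\<forall>\<^sub>F t in at_top. norm (E t * H t) \<le> E t * (2 * \<theta> / m)"
        using eventually_ge_at_top[of "0::real"]
      proof eventually_elim
        case (elim t)
        have "E t * \<bar>H t\<bar> \<le> E t * (2 * \<theta> / m)"
          using H_le[OF elim] by (intro mult_left_mono) (auto simp: E_def)
        then show ?case
          by (simp add: abs_mult E_def)
      qed
      ultimately show "((\<lambda>t. E t * H t) \<longlongrightarrow> 0) at_top"
        by (rule Lim_null_comparison[rotated])
    qed
    then have "((\<lambda>t. E t * D t - w t * H t) has_integral 0) {0..}"
      using \<theta>(1) by (simp add: H_def)
    from has_integral_diff[OF integrable_integral[OF set_borel_integral_eq_integral(1)[OF int_D]] this]
    show ?thesis
      by (simp add: has_integral_iff)
  qed
  also have "\<dots> = (\<integral>t. indicator {0..} t * (w t * H t) \<partial>lborel)"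
    using set_borel_integral_eq_integral(2)[OF int_w] by (simp add: set_lebesgue_integral_def)
  also have "\<dots> = ?P"
    by (simp only: w_def E_def H_def mult.assoc)
  finally show ?thesis
    using G by simp
qed

text \<open>Let \<open>Y\<close> tend to infinity in the truncated formula:
  \<open>ray_integral\<close> tends to \<open>\<theta>\<close> under the weight of mass 1, with
  dominating function \<open>w t * (2 * \<theta> / m)\<close>.\<close>

lemma has_integral_damped_sine_atLeast:
  fixes K m \<theta> :: real and n :: nat
  assumes K: "K > 0" and n: "n > 0" and m: "m > 0" and \<theta>: "0 \<le> \<theta>" "\<theta> \<le> pi / 2"
  shows "((\<lambda>x. - integral {0..} (\<lambda>t. exp (- (K * t ^ n) - m * t * x * cos \<theta>)
             * sin (m * t * x * sin \<theta> - \<theta>))) has_integral \<theta> / m) {0..}"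
proof (rule has_integral_atLeast_limit[OF has_integral_damped_sine[OF assms]])
  define w where "w t = indicator {0..} t * (K * real n * t ^ (n - 1) * exp (- (K * t ^ n)))" for t :: real
  have w: "has_bochner_integral lborel w 1"
    unfolding w_def by (rule has_bochner_integral_power_exp_neg_power[OF K n])
  have w_ge: "w t \<ge> 0" for t
    using K by (auto simp: w_def indicator_def)
  have "((\<lambda>Y. \<integral>t. w t * (ray_integral \<theta> (m * t * Y) / m) \<partial>lborel) \<longlongrightarrow> (\<integral>t. w t * (\<theta> / m) \<partial>lborel)) at_top"
  proof (rule integral_dominated_convergence_at_top)
    show "integrable lborel (\<lambda>t. w t * (2 * \<theta> / m))"
      using w by (intro integrable_mult_left) (auto simp: has_bochner_integral_iff)
    \<comment> \<open>At \<open>t = 0\<close> the argument \<open>m * t * Y\<close> stays 0 instead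
      of tending to infinity; for \<open>t < 0\<close> the weight vanishes.\<close>
    have "((\<lambda>Y. w t * (ray_integral \<theta> (m * t * Y) / m)) \<longlongrightarrow> w t * (\<theta> / m)) at_top" if "t \<noteq> 0" for t
    proof (cases "t > 0")
      case True
      have "filterlim (\<lambda>Y. m * t * Y) at_top at_top"
        using True m
        by (intro filterlim_tendsto_pos_mult_at_top[OF tendsto_const] filterlim_ident) auto
      then show ?thesis
        using m by (intro tendsto_intros filterlim_compose[OF ray_integral_tendsto[OF \<theta>]]) auto
    qed (use that in \<open>simp add: w_def\<close>)
    then show "AE t in lborel. ((\<lambda>Y. w t * (ray_integral \<theta> (m * t * Y) / m)) \<longlongrightarrow> w t * (\<theta> / m)) at_top"
      using AE_lborel_singleton[of "0::real"] by auto
    have "norm (w t * (ray_integral \<theta> (m * t * Y) / m)) \<le> w t * (2 * \<theta> / m)" if "Y \<ge> 0" for Y t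
    proof (cases "t \<ge> 0")
      case True
      then show ?thesis
        using abs_ray_integral_le[OF \<theta>, of "m * t * Y"] m that w_ge[of t]
        by (auto simp: abs_mult intro!: mult_left_mono divide_right_mono)
    qed (simp add: w_def)
    then show "\<forall>\<^sub>F Y in at_top. AE t in lborel. norm (w t * (ray_integral \<theta> (m * t * Y) / m)) \<le> w t * (2 * \<theta> / m)"
      by (intro eventually_mono[OF eventually_ge_at_top[of "0::real"]] AE_I2)
  qed (use \<theta>(1) in \<open>simp_all add: w_def[abs_def]\<close>)
  also have "(\<integral>t. w t * (\<theta> / m) \<partial>lborel) = \<theta> / m"
    using w by (simp add: has_bochner_integral_iff)
  finally show "((\<lambda>Y. \<integral>t. indicator {0..} t * (K * real n * t ^ (n - 1) * exp (- (K * t ^ n)))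
      * (ray_integral \<theta> (m * t * Y) / m) \<partial>lborel) \<longlongrightarrow> \<theta> / m) at_top"
    by (simp add: w_def mult.assoc)
qed

section \<open>Integrals of \<open>F\<close> over half-lines and the whole line\<close>

text \<open>The sign condition confines \<open>\<theta>\<close> to \<open>[0, pi / 2]\<close> when
  \<open>c > 0\<close>. For \<open>c < 0\<close> it confines \<open>pi - \<theta>\<close> to that
  range, and \<open>F\<close> is unchanged when \<open>c\<close> and \<open>\<theta>\<close> become
  \<open>- c\<close> and \<open>pi - \<theta>\<close> outside the coefficient
  \<open>K\<close>.\<close>

lemma F_has_integral_atLeast:
  fixes n :: nat and c \<theta> :: real
  assumes n: "n > 0" and c: "c \<noteq> 0" and nc: "odd n \<or> c < 0" and \<theta>: "\<theta> \<in> {0..pi}" and "0 \<le> c * cos \<theta>"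
  shows "(F n c \<theta> has_integral (if c < 0 then (pi - \<theta>) / (- c) else \<theta> / c)) {0..}"
proof -
  define K where "K = (- c) ^ (n - 1) / real n"
  \<comment> \<open>The parity hypothesis enters here: either the exponent \<open>n - 1\<close> is
    even or the base \<open>- c\<close> is positive.\<close>
  have K: "K > 0"
    using n c nc by (auto simp: K_def zero_less_power_eq)
  show ?thesis
  proof (cases "c > 0")
    case True
    then have "cos \<theta> \<ge> 0"
      using assms(5) by (simp add: zero_le_mult_iff)
    then have "\<theta> \<le> pi / 2"
      using \<theta> cos_mono_le_eq[of "pi / 2" \<theta>] by simp
    moreover have "F n c \<theta> = (\<lambda>x. - integral {0..} (\<lambda>t. exp (- (K * t ^ n) - c * t * x * cos \<theta>)
             * sin (c * t * x * sin \<theta> - \<theta>)))"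
      by (simp add: fun_eq_iff F_def K_def)
    ultimately show ?thesis
      using has_integral_damped_sine_atLeast[OF K n True, of \<theta>] \<theta> True by simp
  next
    case False
    then have c: "c < 0"
      using c by simp
    then have "cos (pi - \<theta>) \<ge> 0"
      using assms(5) by (simp add: zero_le_mult_iff)
    then have "pi - \<theta> \<le> pi / 2"
      using \<theta> cos_mono_le_eq[of "pi / 2" "pi - \<theta>"] by simp
    moreover have "sin (c * t * x * sin \<theta> - \<theta>) = sin (- c * t * x * sin (pi - \<theta>) - (pi - \<theta>))" for t x
    proof -
      have "- c * t * x * sin (pi - \<theta>) - (pi - \<theta>) = - (pi + (c * t * x * sin \<theta> - \<theta>))"
        by simp
      then show ?thesis
        by (simp only: sin_minus sin_periodic_pi2)
    qed
    then have "F n c \<theta> = (\<lambda>x. - integral {0..} (\<lambda>t. exp (- (K * t ^ n) - (- c) * t * x * cos (pi - \<theta>))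
             * sin (- c * t * x * sin (pi - \<theta>) - (pi - \<theta>))))"
      by (simp add: fun_eq_iff F_def K_def)
    ultimately show ?thesis
      using has_integral_damped_sine_atLeast[OF K n, of "- c" "pi - \<theta>"] \<theta> c by simp
  qed
qed

text \<open>For odd \<open>n\<close> the exponent \<open>n - 1\<close> is even, so the coefficient
  of \<open>t ^ n\<close> keeps its value; elsewhere \<open>c\<close> and \<open>x\<close> occur
  only through their product.\<close>

lemma F_uminus:
  assumes "odd n"
  shows "F n (- c) \<theta> (- x) = F n c \<theta> x"
proof -
  have "(- c) ^ (n - 1) = c ^ (n - 1)"
    using assms by (intro power_minus_even) simp
  then show ?thesis
    unfolding F_def by simp
qed

text \<open>Reflection turns this into the result on \<open>{0..}\<close> for \<open>- c\<close>,
  which accounts for the exchanged cases and the reversed sign condition.\<close>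

lemma F_has_integral_atMost:
  fixes n :: nat and c \<theta> :: real
  assumes n: "odd n" and c: "c \<noteq> 0" and \<theta>: "\<theta> \<in> {0..pi}" and "c * cos \<theta> \<le> 0"
  shows "(F n c \<theta> has_integral (if c > 0 then (pi - \<theta>) / c else \<theta> / (- c))) {..0}"
proof -
  have "(F n (- c) \<theta> has_integral (if c > 0 then (pi - \<theta>) / c else \<theta> / (- c))) {0..}"
    using F_has_integral_atLeast[of n "- c" \<theta>] assms by (auto simp: odd_pos)
  then have "((\<lambda>x. F n (- c) \<theta> (- x)) has_integral (if c > 0 then (pi - \<theta>) / c else \<theta> / (- c))) {..0}"
    using has_integral_reflect_image[of "F n (- c) \<theta>" _ "{0..}"] by simp
  then show ?thesis
    using n by (simp add: F_uminus)
qed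

text \<open>At \<open>pi / 2\<close> the cosine vanishes, so both half-line results apply, each
  contributing \<open>(pi / 2) / \<bar>c\<bar>\<close>.\<close>

lemma F_pi_half_has_integral_UNIV:
  fixes n :: nat and c :: real
  assumes "odd n" and "c \<noteq> 0"
  shows "(F n c (pi / 2) has_integral pi / \<bar>c\<bar>) UNIV"
proof -
  have "(F n c (pi / 2) has_integral (pi / 2) / \<bar>c\<bar>) {0..}"
    using F_has_integral_atLeast[of n c "pi / 2"] assms by (auto simp: odd_pos split: if_splits)
  moreover have "(F n c (pi / 2) has_integral (pi / 2) / \<bar>c\<bar>) {..0}"
    using F_has_integral_atMost[of n c "pi / 2"] assms by (auto split: if_splits)
  moreover have "negligible ({0..} \<inter> {..0::real})"
    by (rule negligible_subset[of "{0}"]) auto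
  ultimately have "(F n c (pi / 2) has_integral (pi / 2) / \<bar>c\<bar> + (pi / 2) / \<bar>c\<bar>) ({0..} \<union> {..0})"
    by (rule has_integral_Un)
  moreover have "{0..} \<union> {..0::real} = UNIV"
    by auto
  ultimately show ?thesis
    by (simp add: field_simps)
qed

text \<open>For the lower signs in (c) the sine changes sign, so the value is
  \<open>- (pi / \<bar>c\<bar>)\<close>; a common nonzero value for both sign choices is impossible
  by the oddness of \<open>F\<close> in the angle.\<close>

theorem mainTheorem4:
  fixes n :: nat and c :: real
  assumes "n \<ge> 2" and "c \<noteq> 0" and "odd n \<or> (even n \<and> c < 0)"
  shows
    "(\<forall>\<theta>\<in>{0..pi}. c * cos \<theta> \<ge> 0 \<longrightarrow>
        (F n c \<theta> has_integral (if c < 0 then (pi - \<theta>) / (- c) else \<theta> / c)) {0..})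
     \<and> (\<forall>k::nat. 1 \<le> k \<and> real k \<le> real n / 2 \<and> c * cos (2 * real k * pi / real n) \<ge> 0 \<longrightarrow>
          y_minus n c k = F n c (2 * real k * pi / real n) \<and>
          (y_minus n c k has_integral
             (if c < 0 then (real n - 2 * real k) / (- (real n * c)) * pi
              else 2 * real k / (real n * c) * pi)) {0..})
     \<and> (odd n \<longrightarrow> (\<forall>\<theta>\<in>{0..pi}. c * cos \<theta> \<le> 0 \<longrightarrow>
          (F n c \<theta> has_integral (if c > 0 then (pi - \<theta>) / c else \<theta> / (- c))) {..0}))
     \<and> (odd n \<longrightarrow>
          (\<forall>\<theta>\<in>{-pi<..pi}. cos \<theta> = 0 \<longrightarrow>
             (\<theta> = pi / 2 \<and> sin \<theta> = 1) \<or> (\<theta> = - pi / 2 \<and> sin \<theta> = - 1))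
          \<and> (let G = (\<lambda>x. integral {0..} (\<lambda>t. exp (- ((- c) ^ (n - 1) * (t ^ n / real n)))
                                            * sin (c * t * x - pi / 2)))
             in G integrable_on UNIV \<and> - integral UNIV G = pi / \<bar>c\<bar>)
          \<and> (let G = (\<lambda>x. integral {0..} (\<lambda>t. exp (- ((- c) ^ (n - 1) * (t ^ n / real n)))
                                            * sin (- (c * t * x) + pi / 2)))
             in G integrable_on UNIV \<and> - integral UNIV G = - (pi / \<bar>c\<bar>)))"
proof (intro conjI ballI allI impI)
  fix \<theta> :: real assume "\<theta> \<in> {0..pi}" "c * cos \<theta> \<ge> 0"
  then show "(F n c \<theta> has_integral (if c < 0 then (pi - \<theta>) / (- c) else \<theta> / c)) {0..}"
    using assms by (intro F_has_integral_atLeast) auto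
next
  fix k :: nat
  show "y_minus n c k = F n c (2 * real k * pi / real n)"
    by (rule y_minus_eq_F)
next
  fix k :: nat
  assume k: "1 \<le> k \<and> real k \<le> real n / 2 \<and> c * cos (2 * real k * pi / real n) \<ge> 0"
  \<comment> \<open>The bound \<open>k \<le> n / 2\<close> is what places the angle in
    \<open>[0, pi]\<close>.\<close>
  have "2 * real k * pi \<le> pi * real n"
    using k mult_right_mono[of "2 * real k" "real n" pi] by (simp add: mult.commute)
  then have "2 * real k * pi / real n \<in> {0..pi}"
    using assms(1) by (auto simp: field_simps)
  then have "(F n c (2 * real k * pi / real n) has_integral
      (if c < 0 then (pi - 2 * real k * pi / real n) / (- c) else 2 * real k * pi / real n / c)) {0..}"
    using assms k by (intro F_has_integral_atLeast) auto
  moreover have "(pi - 2 * real k * pi / real n) / (- c) = (real n - 2 * real k) / (- (real n * c)) * pi"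
    "2 * real k * pi / real n / c = 2 * real k / (real n * c) * pi"
    using assms(1,2) by (simp_all add: field_simps)
  ultimately show "(y_minus n c k has_integral
             (if c < 0 then (real n - 2 * real k) / (- (real n * c)) * pi
              else 2 * real k / (real n * c) * pi)) {0..}"
    by (simp only: y_minus_eq_F)
next
  fix \<theta> :: real assume "odd n" "\<theta> \<in> {0..pi}" "c * cos \<theta> \<le> 0"
  then show "(F n c \<theta> has_integral (if c > 0 then (pi - \<theta>) / c else \<theta> / (- c))) {..0}"
    using assms by (intro F_has_integral_atMost)
next
  fix \<theta> :: real assume \<theta>: "\<theta> \<in> {-pi<..pi}" "cos \<theta> = 0"
  \<comment> \<open>Passing to \<open>\<bar>\<theta>\<bar>\<close> reaches \<open>[0, pi]\<close>,
    where cosine is injective.\<close>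
  then have "cos \<bar>\<theta>\<bar> = cos (pi / 2)" "\<bar>\<theta>\<bar> \<le> pi"
    by auto
  then have "\<bar>\<theta>\<bar> = pi / 2"
    using cos_inj_pi[of "\<bar>\<theta>\<bar>" "pi / 2"] by simp
  then have "\<theta> = pi / 2 \<or> \<theta> = - pi / 2"
    by linarith
  moreover have "sin (- pi / 2) = - 1"
    using sin_minus[of "pi / 2"] by simp
  ultimately show "(\<theta> = pi / 2 \<and> sin \<theta> = 1) \<or> (\<theta> = - pi / 2 \<and> sin \<theta> = - 1)"
    by fastforce
next
  assume n: "odd n"
  let ?G = "\<lambda>x. integral {0..} (\<lambda>t. exp (- ((- c) ^ (n - 1) * (t ^ n / real n))) * sin (c * t * x - pi / 2))"
  let ?G' = "\<lambda>x. integral {0..} (\<lambda>t. exp (- ((- c) ^ (n - 1) * (t ^ n / real n))) * sin (- (c * t * x) + pi / 2))"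
  have F: "(F n c (pi / 2) has_integral pi / \<bar>c\<bar>) UNIV"
    by (rule F_pi_half_has_integral_UNIV[OF n assms(2)])
  have "?G = (\<lambda>x. - F n c (pi / 2) x)"
    by (simp add: F_def)
  then have "(?G has_integral - (pi / \<bar>c\<bar>)) UNIV"
    using has_integral_neg[OF F] by simp
  then show "let G = ?G in G integrable_on UNIV \<and> - integral UNIV G = pi / \<bar>c\<bar>"
    by (simp add: Let_def has_integral_iff)
  have "sin (- (c * t * x) + pi / 2) = - sin (c * t * x - pi / 2)" for t x
    using sin_minus[of "c * t * x - pi / 2"] by simp
  then have "?G' = F n c (pi / 2)"
    by (simp add: fun_eq_iff F_def integral_neg)
  then have "(?G' has_integral pi / \<bar>c\<bar>) UNIV"
    using F by simp
  then show "let G = ?G' in G integrable_on UNIV \<and> - integral UNIV G = - (pi / \<bar>c\<bar>)"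
    by (simp add: Let_def has_integral_iff)
qed

end
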